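(* Let $M$ and $N$ be two monoids. Let $A$ be an $M$-act defined by a presentation $\langle X\,|\,R\rangle$, and let $B$ be an $N$-act defined by a presentation $\langle Y\,|\,S\rangle$. Define the following sets of relations on the free $\mathcal{W}(M,N|A)$-act on $X\times Y$: \begin{align*} T_1&=\{(x,y)\cdot(1,\theta)=(x,y)\cdot(1,c_{x\theta}) : x\in X,\ y\in Y,\ \theta\in N^A\};\\ T_2&=\{(x,y)\cdot(m,c_1)=(x',y)\cdot(m',c_1) : (x\cdot m,\,x'\cdot m')\in R,\ y\in Y\};\\ T_3&=\{(x,y)\cdot(1,c_n)=(x,y')\cdot(1,c_{n'}) : x\in X,\ (y\cdot n,\,y'\cdot n')\in S\}. \end{align*} Then the $\mathcal{W}(M,N|A)$-act $A\wr B$ is defined by the presentation $\langle X\times Y\,|\,T_1,T_2,T_3\rangle$ (the generator $(x,y)$ representing the element $(x,y)$ of $A\wr B$).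
   Context: For a monoid $M$ with identity $1$, an $M$-act is a non-empty set $A$ with a map $A\times M\to A$, $(a,m)\mapsto am$, such that $a(mn)=(am)n$ and $a1=a$. For a non-empty set $X$, $F_X$ is the free $M$-act $X\times M$ with action $(x,m)n=(x,mn)$; the element $(x,m)$ is written $x\cdot m$. A congruence on an $M$-act is an equivalence relation $\rho$ such that $(a,b)\in\rho$ implies $(am,bm)\in\rho$ for all $m\in M$. An $M$-act $A$ is defined by the presentation $\langle X\,|\,R\rangle$, where $R\subseteq F_X\times F_X$, if $A\cong F_X/\rho$ with $\rho$ the smallest congruence on $F_X$ containing $R$. Pairs $(u,v)$ in $R$ are written as relations $u=v$. A generator $x\in X$ also denotes the element of $A$ it represents (so $x\theta$ makes sense for $\theta$ a map with domain $A$). Wreath products: let $M,N$ be monoids, $A$ an $M$-act, $B$ an $N$-act. $N^A$ is the monoid of all maps $A\to N$ (written on the right) under pointwise multiplication $a(\theta\phi)=(a\theta)(a\phi)$; $c_n\in N^A$ is the constant map with value $n$. For $m\in M$ and $\phi\in N^A$, ${}^m\phi\in N^A$ is given by $a\,{}^m\phi=(am)\phi$. The monoid $\mathcal{W}(M,N|A)$ is the set $M\times N^A$ with multiplication $(m,\theta)(n,\phi)=(mn,\theta\,{}^m\phi)$. The wreath product $A\wr B$ is the $\mathcal{W}(M,N|A)$-act with underlying set $A\times B$ and action $(a,b)(m,\theta)=(am,b(a\theta))$. *)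

theory Defs
  imports "HOL-Algebra.Group"
begin

record ('a, 'm) right_act = "'a partial_object" +
  act :: "['a, 'm] \<Rightarrow> 'a" (infixl \<open>\<star>\<index>\<close> 75)

locale monoid_act = monoid M for M (structure) +
  fixes A :: "('a, 'm, 'c) right_act_scheme"
  constrains M :: "('m, 'b) monoid_scheme"
  assumes nonempty: "carrier A \<noteq> {}"
    and act_closed: "\<lbrakk>a \<in> carrier A; m \<in> carrier M\<rbrakk> \<Longrightarrow> a \<star>\<^bsub>A\<^esub> m \<in> carrier A"
    and act_mult: "\<lbrakk>a \<in> carrier A; m \<in> carrier M; n \<in> carrier M\<rbrakk>
      \<Longrightarrow> a \<star>\<^bsub>A\<^esub> (m \<otimes> n) = (a \<star>\<^bsub>A\<^esub> m) \<star>\<^bsub>A\<^esub> n"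
    and act_one: "a \<in> carrier A \<Longrightarrow> a \<star>\<^bsub>A\<^esub> \<one> = a"

definition free_act :: "('m, 'b) monoid_scheme \<Rightarrow> 'x set \<Rightarrow> ('x \<times> 'm, 'm) right_act" where
  "free_act M X = \<lparr>carrier = X \<times> carrier M, act = (\<lambda>(x, m) n. (x, m \<otimes>\<^bsub>M\<^esub> n))\<rparr>"

definition act_congruence ::
    "('m, 'b) monoid_scheme \<Rightarrow> ('a, 'm, 'c) right_act_scheme \<Rightarrow> ('a \<times> 'a) set \<Rightarrow> bool" where
  "act_congruence M A \<rho> \<longleftrightarrow> equiv (carrier A) \<rho> \<and>
     (\<forall>(a, b)\<in>\<rho>. \<forall>m\<in>carrier M. (a \<star>\<^bsub>A\<^esub> m, b \<star>\<^bsub>A\<^esub> m) \<in> \<rho>)"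

definition generated_congruence ::
    "('m, 'b) monoid_scheme \<Rightarrow> ('a, 'm, 'c) right_act_scheme \<Rightarrow> ('a \<times> 'a) set \<Rightarrow> ('a \<times> 'a) set" where
  "generated_congruence M A R = \<Inter>{\<rho>. act_congruence M A \<rho> \<and> R \<subseteq> \<rho>}"

text \<open>For a congruence \<open>\<rho>\<close>, all the classes in the union below coincide, so that the class of
  \<open>a\<close> is sent by \<open>m\<close> to the class of \<open>am\<close>.\<close>

definition quotient_act ::
    "('a, 'm, 'c) right_act_scheme \<Rightarrow> ('a \<times> 'a) set \<Rightarrow> ('a set, 'm) right_act" where
  "quotient_act A \<rho> =
     \<lparr>carrier = carrier A // \<rho>, act = (\<lambda>C m. \<Union>a\<in>C. \<rho> `` {a \<star>\<^bsub>A\<^esub> m})\<rparr>"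

definition act_iso ::
    "('m, 'b) monoid_scheme \<Rightarrow> ('a, 'm, 'c) right_act_scheme \<Rightarrow> ('d, 'm, 'e) right_act_scheme
      \<Rightarrow> ('a \<Rightarrow> 'd) set" where
  "act_iso M A B = {h. bij_betw h (carrier A) (carrier B) \<and>
     (\<forall>a\<in>carrier A. \<forall>m\<in>carrier M. h (a \<star>\<^bsub>A\<^esub> m) = h a \<star>\<^bsub>B\<^esub> m)}"

text \<open>\<open>defined_by_presentation M A X R \<iota>\<close>: the \<open>M\<close>-act \<open>A\<close> is defined by the presentation
  \<open>\<langle>X | R\<rangle>\<close>, with the generator \<open>x\<close> representing the element \<open>\<iota> x\<close> of \<open>A\<close>. The map \<open>\<iota>\<close> is
  determined by the chosen isomorphism; it is made explicit because generators are also used as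
  elements of \<open>A\<close>.\<close>

definition defined_by_presentation ::
    "('m, 'b) monoid_scheme \<Rightarrow> ('a, 'm, 'c) right_act_scheme \<Rightarrow> 'x set
      \<Rightarrow> (('x \<times> 'm) \<times> ('x \<times> 'm)) set \<Rightarrow> ('x \<Rightarrow> 'a) \<Rightarrow> bool" where
  "defined_by_presentation M A X R \<iota> \<longleftrightarrow>
     monoid_act M A \<and> X \<noteq> {} \<and>
     R \<subseteq> carrier (free_act M X) \<times> carrier (free_act M X) \<and>
     (let \<rho> = generated_congruence M (free_act M X) R
      in \<exists>h \<in> act_iso M (quotient_act (free_act M X) \<rho>) A.
           \<forall>x\<in>X. h (\<rho> `` {(x, \<one>\<^bsub>M\<^esub>)}) = \<iota> x)"

text \<open>Maps with domain \<open>A\<close> are represented by extensional functions, so that equality of elements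
  of \<open>N\<^sup>A\<close> is equality of functions on \<open>carrier A\<close>.\<close>

definition const_map ::
    "('a, 'm, 'c) right_act_scheme \<Rightarrow> 'n \<Rightarrow> 'a \<Rightarrow> 'n" where
  "const_map A n = (\<lambda>a\<in>carrier A. n)"

definition pointwise_mult ::
    "('n, 'd) monoid_scheme \<Rightarrow> ('a, 'm, 'c) right_act_scheme \<Rightarrow> ('a \<Rightarrow> 'n) \<Rightarrow> ('a \<Rightarrow> 'n) \<Rightarrow> 'a \<Rightarrow> 'n" where
  "pointwise_mult N A \<theta> \<phi> = (\<lambda>a\<in>carrier A. \<theta> a \<otimes>\<^bsub>N\<^esub> \<phi> a)"

definition shift_map ::
    "('a, 'm, 'c) right_act_scheme \<Rightarrow> 'm \<Rightarrow> ('a \<Rightarrow> 'n) \<Rightarrow> 'a \<Rightarrow> 'n" where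
  "shift_map A m \<phi> = (\<lambda>a\<in>carrier A. \<phi> (a \<star>\<^bsub>A\<^esub> m))"

definition wreath_monoid ::
    "('m, 'b) monoid_scheme \<Rightarrow> ('n, 'd) monoid_scheme \<Rightarrow> ('a, 'm, 'c) right_act_scheme
      \<Rightarrow> ('m \<times> ('a \<Rightarrow> 'n)) monoid" where
  "wreath_monoid M N A =
     \<lparr>carrier = carrier M \<times> (carrier A \<rightarrow>\<^sub>E carrier N),
      mult = (\<lambda>(m, \<theta>) (n, \<phi>). (m \<otimes>\<^bsub>M\<^esub> n, pointwise_mult N A \<theta> (shift_map A m \<phi>))),
      one = (\<one>\<^bsub>M\<^esub>, const_map A \<one>\<^bsub>N\<^esub>)\<rparr>"

definition wreath_act ::
    "('a, 'm, 'c) right_act_scheme \<Rightarrow> ('b, 'n, 'd) right_act_scheme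
      \<Rightarrow> ('a \<times> 'b, 'm \<times> ('a \<Rightarrow> 'n)) right_act" where
  "wreath_act A B =
     \<lparr>carrier = carrier A \<times> carrier B,
      act = (\<lambda>(a, b) (m, \<theta>). (a \<star>\<^bsub>A\<^esub> m, b \<star>\<^bsub>B\<^esub> \<theta> a))\<rparr>"

end

theory Submission
  imports Defs
begin

text \<open>Let \<open>\<tau>\<close> be the congruence generated by \<open>T\<^sub>1 \<union> T\<^sub>2 \<union> T\<^sub>3\<close>. The three sets of relations hold in
  \<open>A \<wr> B\<close>, so \<open>\<tau>\<close> is contained in the kernel of the map sending \<open>(x, y) \<cdot> (m, \<theta>)\<close> to
  \<open>(xm, y(x\<theta>))\<close>. Conversely, since \<open>(1, \<theta>)(m, c\<^sub>1) = (m, \<theta>)\<close>, the relations \<open>T\<^sub>1\<close> make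
  \<open>(x, y) \<cdot> (m, \<theta>)\<close> equivalent to \<open>(x, y) \<cdot> (m, c\<^sub>n)\<close> with \<open>n = x\<theta>\<close>. The map
  \<open>x \<cdot> m \<mapsto> (x, y) \<cdot> (m, c\<^sub>1)\<close> is equivariant along \<open>m \<mapsto> (m, c\<^sub>1)\<close>, so by \<open>T\<^sub>2\<close> it takes the
  consequences of \<open>R\<close> into \<open>\<tau>\<close>; likewise \<open>y \<cdot> n \<mapsto> (x, y) \<cdot> (1, c\<^sub>n)\<close> and \<open>S\<close> by \<open>T\<^sub>3\<close>. As
  \<open>(m, c\<^sub>1)(1, c\<^sub>n) = (m, c\<^sub>n) = (1, c\<^sub>n)(m, c\<^sub>1)\<close>, the two coordinates can be changed one after the
  other.\<close>

section \<open>Congruences on acts: pullback and generation\<close>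

lemma act_congruence_pullback:
  assumes \<sigma>: "act_congruence K C \<sigma>"
    and f: "\<And>a. a \<in> carrier A \<Longrightarrow> f a \<in> carrier C"
    and g: "\<And>m. m \<in> carrier M \<Longrightarrow> g m \<in> carrier K"
    and equivariant: "\<And>a m. \<lbrakk>a \<in> carrier A; m \<in> carrier M\<rbrakk> \<Longrightarrow> f (a \<star>\<^bsub>A\<^esub> m) = f a \<star>\<^bsub>C\<^esub> g m"
    and closed: "\<And>a m. \<lbrakk>a \<in> carrier A; m \<in> carrier M\<rbrakk> \<Longrightarrow> a \<star>\<^bsub>A\<^esub> m \<in> carrier A"
  shows "act_congruence M A {(a, b). a \<in> carrier A \<and> b \<in> carrier A \<and> (f a, f b) \<in> \<sigma>}"
proof -
  have E: "equiv (carrier C) \<sigma>"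
    and stable: "\<And>a b m. \<lbrakk>(a, b) \<in> \<sigma>; m \<in> carrier K\<rbrakk> \<Longrightarrow> (a \<star>\<^bsub>C\<^esub> m, b \<star>\<^bsub>C\<^esub> m) \<in> \<sigma>"
    using \<sigma> by (auto simp: act_congruence_def)
  have "refl_on (carrier C) \<sigma>" "sym \<sigma>" "trans \<sigma>"
    using E by (auto elim: equivE)
  then have "equiv (carrier A) {(a, b). a \<in> carrier A \<and> b \<in> carrier A \<and> (f a, f b) \<in> \<sigma>}"
    using f by (intro equivI refl_onI symI transI) (auto dest: refl_onD symD transD)
  then show ?thesis
    unfolding act_congruence_def using stable f g equivariant closed by auto
qed

lemma generated_congruence_least:
  assumes "act_congruence M A \<sigma>" and "R \<subseteq> \<sigma>"
  shows "generated_congruence M A R \<subseteq> \<sigma>"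
  using assms unfolding generated_congruence_def by blast

lemma subset_generated_congruence: "R \<subseteq> generated_congruence M A R"
  unfolding generated_congruence_def by blast

text \<open>The pullback of \<open>\<sigma>\<close> along \<open>f\<close> is a congruence
  containing \<open>R\<close>, hence contains all consequences of \<open>R\<close>. Two monoids
  linked by \<open>g\<close> occur because \<open>f\<close> will also lead from free acts over
  \<open>M\<close> and \<open>N\<close> to one over the wreath monoid.\<close>

lemma generated_congruence_map:
  assumes "(a, b) \<in> generated_congruence M A R"
    and "act_congruence K C \<sigma>"
    and "R \<subseteq> carrier A \<times> carrier A"
    and "\<And>a b. (a, b) \<in> R \<Longrightarrow> (f a, f b) \<in> \<sigma>"
    and "\<And>a. a \<in> carrier A \<Longrightarrow> f a \<in> carrier C"
    and "\<And>m. m \<in> carrier M \<Longrightarrow> g m \<in> carrier K"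
    and "\<And>a m. \<lbrakk>a \<in> carrier A; m \<in> carrier M\<rbrakk> \<Longrightarrow> f (a \<star>\<^bsub>A\<^esub> m) = f a \<star>\<^bsub>C\<^esub> g m"
    and "\<And>a m. \<lbrakk>a \<in> carrier A; m \<in> carrier M\<rbrakk> \<Longrightarrow> a \<star>\<^bsub>A\<^esub> m \<in> carrier A"
  shows "(f a, f b) \<in> \<sigma>"
proof -
  let ?P = "{(a, b). a \<in> carrier A \<and> b \<in> carrier A \<and> (f a, f b) \<in> \<sigma>}"
  have "act_congruence M A ?P"
    using assms by (intro act_congruence_pullback) auto
  moreover have "R \<subseteq> ?P"
    using assms(3,4) by auto
  ultimately show ?thesis
    using generated_congruence_least assms(1) by blast
qed

text \<open>All four properties pass from the members of a family of congruences to its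
  intersection. The family must be non-empty, as an empty intersection is the universal relation of
  the type; \<open>R\<close> and \<open>closed\<close> make the total relation on
  \<open>carrier A\<close> a member.\<close>

lemma act_congruence_generated:
  assumes R: "R \<subseteq> carrier A \<times> carrier A"
    and closed: "\<And>a m. \<lbrakk>a \<in> carrier A; m \<in> carrier M\<rbrakk> \<Longrightarrow> a \<star>\<^bsub>A\<^esub> m \<in> carrier A"
  shows "act_congruence M A (generated_congruence M A R)"
proof -
  let ?G = "generated_congruence M A R"
  let ?F = "{\<rho>. act_congruence M A \<rho> \<and> R \<subseteq> \<rho>}"
  have "act_congruence M A (carrier A \<times> carrier A)"
    using closed by (auto simp: act_congruence_def equiv_def refl_on_def sym_def trans_def)
  then have sub: "?G \<subseteq> carrier A \<times> carrier A"
    using R by (rule generated_congruence_least)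
  have E: "equiv (carrier A) \<rho>" if "\<rho> \<in> ?F" for \<rho>
    using that by (simp add: act_congruence_def)
  then have "refl_on (carrier A) \<rho>" "sym \<rho>" "trans \<rho>" if "\<rho> \<in> ?F" for \<rho>
    using that by (auto elim: equivE)
  then have "refl_on (carrier A) ?G" "sym ?G" "trans ?G"
    unfolding generated_congruence_def
    by (blast intro: refl_onI dest: refl_onD, blast intro: symI dest: symD,
        blast intro: transI dest: transD)
  then have "equiv (carrier A) ?G"
    using sub by (intro equivI) auto
  moreover have "\<forall>(a, b)\<in>?G. \<forall>m\<in>carrier M. (a \<star>\<^bsub>A\<^esub> m, b \<star>\<^bsub>A\<^esub> m) \<in> ?G"
    unfolding generated_congruence_def act_congruence_def by fast
  ultimately show ?thesis
    by (simp add: act_congruence_def)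
qed

section \<open>Free acts, quotients and a criterion for presentations\<close>

lemma carrier_free_act [simp]: "carrier (free_act M X) = X \<times> carrier M"
  by (simp add: free_act_def)

lemma act_free_act [simp]: "(x, m) \<star>\<^bsub>free_act M X\<^esub> n = (x, m \<otimes>\<^bsub>M\<^esub> n)"
  by (simp add: free_act_def)

lemma free_act_closed:
  assumes "monoid M" and "a \<in> carrier (free_act M X)" and "m \<in> carrier M"
  shows "a \<star>\<^bsub>free_act M X\<^esub> m \<in> carrier (free_act M X)"
  using assms by (cases a) (simp add: monoid.m_closed)

lemma quotient_act_class:
  assumes \<rho>: "act_congruence M A \<rho>" and a: "a \<in> carrier A" and m: "m \<in> carrier M"
  shows "\<rho> `` {a} \<star>\<^bsub>quotient_act A \<rho>\<^esub> m = \<rho> `` {a \<star>\<^bsub>A\<^esub> m}"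
proof -
  have E: "equiv (carrier A) \<rho>"
    using \<rho> by (simp add: act_congruence_def)
  have stable: "(a \<star>\<^bsub>A\<^esub> m, b \<star>\<^bsub>A\<^esub> m) \<in> \<rho>" if "(a, b) \<in> \<rho>" for b
    using \<rho> m that by (auto simp: act_congruence_def)
  have eq_class: "\<rho> `` {b \<star>\<^bsub>A\<^esub> m} = \<rho> `` {a \<star>\<^bsub>A\<^esub> m}" if "b \<in> \<rho> `` {a}" for b
    using that stable equiv_class_eq[OF E] by blast
  have "a \<in> \<rho> `` {a}"
    using E a by (rule equiv_class_self)
  then have "(\<Union>b\<in>\<rho> `` {a}. \<rho> `` {b \<star>\<^bsub>A\<^esub> m}) = \<rho> `` {a \<star>\<^bsub>A\<^esub> m}"
    using eq_class by (rule UN_constant_eq[OF _ ballI])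
  then show ?thesis
    by (simp add: quotient_act_def)
qed

text \<open>First isomorphism theorem for the map from the free act sending (x, m) to the element
  represented by x, acted on by m: it induces an isomorphism on the quotient exactly when it lands
  in \<open>A\<close>, is onto and has kernel \<open>\<rho>\<close>. Presentations can then be
  checked on elements, without classes.\<close>

lemma defined_by_presentation_iff:
  fixes M (structure)
  assumes A: "monoid_act M A" and X: "X \<noteq> {}"
    and R: "R \<subseteq> carrier (free_act M X) \<times> carrier (free_act M X)"
  defines "\<rho> \<equiv> generated_congruence M (free_act M X) R"
  shows "defined_by_presentation M A X R \<iota> \<longleftrightarrow>
    (\<forall>x\<in>X. \<iota> x \<in> carrier A) \<and>
    (\<forall>a\<in>carrier A. \<exists>x\<in>X. \<exists>m\<in>carrier M. a = \<iota> x \<star>\<^bsub>A\<^esub> m) \<and>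
    (\<forall>x\<in>X. \<forall>m\<in>carrier M. \<forall>x'\<in>X. \<forall>m'\<in>carrier M.
      ((x, m), (x', m')) \<in> \<rho> \<longleftrightarrow> \<iota> x \<star>\<^bsub>A\<^esub> m = \<iota> x' \<star>\<^bsub>A\<^esub> m')"
    (is "_ \<longleftrightarrow> ?gens \<and> ?surj \<and> ?ker")
proof -
  interpret monoid_act M A by (fact A)
  let ?F = "free_act M X"
  let ?Q = "quotient_act ?F \<rho>"
  have \<rho>: "act_congruence M ?F \<rho>"
    unfolding \<rho>_def using R by (intro act_congruence_generated) auto
  then have E: "equiv (X \<times> carrier M) \<rho>"
    by (simp add: act_congruence_def)
  have Q: "carrier ?Q = (X \<times> carrier M) // \<rho>"
    by (simp add: quotient_act_def)
  have Q_act: "\<rho> `` {(x, m)} \<star>\<^bsub>?Q\<^esub> n = \<rho> `` {(x, m \<otimes> n)}"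
    if "x \<in> X" "m \<in> carrier M" "n \<in> carrier M" for x m n
    using quotient_act_class[OF \<rho>, of "(x, m)" n] that by simp
  have eq_iff: "\<rho> `` {u} = \<rho> `` {v} \<longleftrightarrow> (u, v) \<in> \<rho>"
    if "u \<in> X \<times> carrier M" "v \<in> X \<times> carrier M" for u v
    using eq_equiv_class_iff[OF E that] .
  have *: "defined_by_presentation M A X R \<iota> \<longleftrightarrow>
      (\<exists>h \<in> act_iso M ?Q A. \<forall>x\<in>X. h (\<rho> `` {(x, \<one>)}) = \<iota> x)"
    using A X R by (simp add: defined_by_presentation_def \<rho>_def Let_def)
  show ?thesis
  proof
    assume "defined_by_presentation M A X R \<iota>"
    then obtain h where bij: "bij_betw h ((X \<times> carrier M) // \<rho>) (carrier A)"
      and hom: "\<And>c m. \<lbrakk>c \<in> (X \<times> carrier M) // \<rho>; m \<in> carrier M\<rbrakk> \<Longrightarrow> h (c \<star>\<^bsub>?Q\<^esub> m) = h c \<star>\<^bsub>A\<^esub> m"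
      and gen: "\<And>x. x \<in> X \<Longrightarrow> h (\<rho> `` {(x, \<one>)}) = \<iota> x"
      unfolding * by (auto simp: act_iso_def Q)
    \<comment> \<open>In the free act (x, m) is (x, 1) acted on by m, so the values of
      \<open>h\<close> on generators determine it on every class.\<close>
    have h: "h (\<rho> `` {(x, m)}) = \<iota> x \<star>\<^bsub>A\<^esub> m" if "x \<in> X" "m \<in> carrier M" for x m
      using that hom[of "\<rho> `` {(x, \<one>)}" m] Q_act[of x \<one> m] gen
      by (simp add: quotientI)
    have ?gens
      using gen bij_betwE[OF bij] by (metis SigmaI one_closed quotientI)
    moreover have ?surj
    proof
      fix a assume "a \<in> carrier A"
      then obtain c where "c \<in> (X \<times> carrier M) // \<rho>" "a = h c"
        using bij by (auto simp: bij_betw_def)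
      then show "\<exists>x\<in>X. \<exists>m\<in>carrier M. a = \<iota> x \<star>\<^bsub>A\<^esub> m"
        using h by (auto elim!: quotientE)
    qed
    moreover have ?ker
    proof (intro ballI)
      fix x m x' m' assume xm: "x \<in> X" "m \<in> carrier M" "x' \<in> X" "m' \<in> carrier M"
      have "((x, m), (x', m')) \<in> \<rho> \<longleftrightarrow> \<rho> `` {(x, m)} = \<rho> `` {(x', m')}"
        using eq_iff xm by simp
      also have "\<dots> \<longleftrightarrow> h (\<rho> `` {(x, m)}) = h (\<rho> `` {(x', m')})"
        using bij xm by (auto simp: bij_betw_def quotientI dest!: inj_onD)
      finally show "((x, m), (x', m')) \<in> \<rho> \<longleftrightarrow> \<iota> x \<star>\<^bsub>A\<^esub> m = \<iota> x' \<star>\<^bsub>A\<^esub> m'"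
        using h xm by simp
    qed
    ultimately show "?gens \<and> ?surj \<and> ?ker" by blast
  next
    assume asm: "?gens \<and> ?surj \<and> ?ker"
    then have gens: ?gens and surj: ?surj and ker: ?ker by blast+
    \<comment> \<open>The value of \<open>h\<close> is the common value on a class;
      \<open>the_elem\<close> is justified by \<open>?ker\<close>, which makes the image of each
      class a singleton.\<close>
    define h where "h c = the_elem ((\<lambda>u. \<iota> (fst u) \<star>\<^bsub>A\<^esub> snd u) ` c)" for c
    have h: "h (\<rho> `` {(x, m)}) = \<iota> x \<star>\<^bsub>A\<^esub> m" if xm: "x \<in> X" "m \<in> carrier M" for x m
    proof -
      have "\<iota> x' \<star>\<^bsub>A\<^esub> m' = \<iota> x \<star>\<^bsub>A\<^esub> m" if "(x', m') \<in> \<rho> `` {(x, m)}" for x' m'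
      proof -
        have "x' \<in> X" "m' \<in> carrier M"
          using that equiv_type[OF E] by auto
        then show ?thesis
          using that xm ker by auto
      qed
      moreover have "(x, m) \<in> \<rho> `` {(x, m)}"
        using equiv_class_self[OF E] xm by simp
      ultimately have "(\<lambda>u. \<iota> (fst u) \<star>\<^bsub>A\<^esub> snd u) ` (\<rho> `` {(x, m)}) = {\<iota> x \<star>\<^bsub>A\<^esub> m}"
        by (force simp del: Image_singleton_iff)
      then show ?thesis by (simp add: h_def)
    qed
    have "inj_on h ((X \<times> carrier M) // \<rho>)"
    proof (rule inj_onI)
      fix c d assume c: "c \<in> (X \<times> carrier M) // \<rho>" and d: "d \<in> (X \<times> carrier M) // \<rho>"
        and eq: "h c = h d"
      obtain x m where xm: "x \<in> X" "m \<in> carrier M" "c = \<rho> `` {(x, m)}"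
        using c by (auto elim: quotientE)
      obtain x' m' where xm': "x' \<in> X" "m' \<in> carrier M" "d = \<rho> `` {(x', m')}"
        using d by (auto elim: quotientE)
      have "\<iota> x \<star>\<^bsub>A\<^esub> m = \<iota> x' \<star>\<^bsub>A\<^esub> m'"
        using eq h xm xm' by simp
      then have "((x, m), (x', m')) \<in> \<rho>"
        using ker xm xm' by blast
      then show "c = d"
        using eq_iff xm xm' by simp
    qed
    moreover have "h ` ((X \<times> carrier M) // \<rho>) = carrier A"
    proof
      show "h ` ((X \<times> carrier M) // \<rho>) \<subseteq> carrier A"
        using gens act_closed by (auto simp: h elim!: quotientE)
      show "carrier A \<subseteq> h ` ((X \<times> carrier M) // \<rho>)"
      proof
        fix a assume "a \<in> carrier A"
        then obtain x m where "x \<in> X" "m \<in> carrier M" "a = \<iota> x \<star>\<^bsub>A\<^esub> m"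
          using surj by blast
        then show "a \<in> h ` ((X \<times> carrier M) // \<rho>)"
          using h by (intro image_eqI[of _ _ "\<rho> `` {(x, m)}"]) (auto simp: quotientI)
      qed
    qed
    moreover have "h (c \<star>\<^bsub>?Q\<^esub> n) = h c \<star>\<^bsub>A\<^esub> n"
      if "c \<in> (X \<times> carrier M) // \<rho>" "n \<in> carrier M" for c n
      using that gens by (auto simp: Q_act h act_mult elim!: quotientE)
    ultimately have "h \<in> act_iso M ?Q A"
      by (simp add: act_iso_def Q bij_betw_def)
    then show "defined_by_presentation M A X R \<iota>"
      unfolding * using h gens act_one by (intro bexI[of _ h]) auto
  qed
qed

section \<open>The wreath monoid and the wreath act\<close>

lemma const_map_closed: "n \<in> carrier N \<Longrightarrow> const_map A n \<in> carrier A \<rightarrow>\<^sub>E carrier N"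
  by (auto simp: const_map_def)

lemma const_map_apply [simp]: "a \<in> carrier A \<Longrightarrow> const_map A n a = n"
  by (simp add: const_map_def)

lemma carrier_wreath_monoid [simp]:
  "carrier (wreath_monoid M N A) = carrier M \<times> (carrier A \<rightarrow>\<^sub>E carrier N)"
  by (simp add: wreath_monoid_def)

lemma one_wreath_monoid [simp]: "\<one>\<^bsub>wreath_monoid M N A\<^esub> = (\<one>\<^bsub>M\<^esub>, const_map A \<one>\<^bsub>N\<^esub>)"
  by (simp add: wreath_monoid_def)

lemma mult_wreath_monoid:
  "(m, \<theta>) \<otimes>\<^bsub>wreath_monoid M N A\<^esub> (n, \<phi>) =
    (m \<otimes>\<^bsub>M\<^esub> n, \<lambda>a\<in>carrier A. \<theta> a \<otimes>\<^bsub>N\<^esub> \<phi> (a \<star>\<^bsub>A\<^esub> m))"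
  by (auto simp: wreath_monoid_def pointwise_mult_def shift_map_def)

lemma carrier_wreath_act [simp]: "carrier (wreath_act A B) = carrier A \<times> carrier B"
  by (simp add: wreath_act_def)

lemma act_wreath_act [simp]: "(a, b) \<star>\<^bsub>wreath_act A B\<^esub> (m, \<theta>) = (a \<star>\<^bsub>A\<^esub> m, b \<star>\<^bsub>B\<^esub> \<theta> a)"
  by (simp add: wreath_act_def)

text \<open>For associativity of the product of (m, \<theta>), (n, \<phi>) and (k, \<psi>), both
  bracketings send \<open>a\<close> to \<theta>(a) \<phi>(am) \<psi>(amn) in the second coordinate,
  since a(mn) = (am)n. Extensionality reduces equality of maps to their values on
  \<open>carrier A\<close>.\<close>

lemma monoid_wreath_monoid:
  assumes "monoid_act M A" and "monoid N"
  shows "monoid (wreath_monoid M N A)"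
proof -
  interpret A: monoid_act M A by fact
  interpret N: monoid N by fact
  show ?thesis
  proof (rule monoidI)
    fix u v assume "u \<in> carrier (wreath_monoid M N A)" "v \<in> carrier (wreath_monoid M N A)"
    then show "u \<otimes>\<^bsub>wreath_monoid M N A\<^esub> v \<in> carrier (wreath_monoid M N A)"
      by (cases u; cases v) (auto simp: mult_wreath_monoid A.act_closed PiE_iff)
  next
    show "\<one>\<^bsub>wreath_monoid M N A\<^esub> \<in> carrier (wreath_monoid M N A)"
      by (simp add: const_map_closed)
  next
    fix u v w assume "u \<in> carrier (wreath_monoid M N A)" "v \<in> carrier (wreath_monoid M N A)"
      "w \<in> carrier (wreath_monoid M N A)"
    then show "u \<otimes>\<^bsub>wreath_monoid M N A\<^esub> v \<otimes>\<^bsub>wreath_monoid M N A\<^esub> w =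
        u \<otimes>\<^bsub>wreath_monoid M N A\<^esub> (v \<otimes>\<^bsub>wreath_monoid M N A\<^esub> w)"
      by (cases u; cases v; cases w)
        (auto simp: mult_wreath_monoid A.act_closed A.act_mult PiE_iff A.m_assoc N.m_assoc
          intro!: restrict_ext)
  next
    fix u assume "u \<in> carrier (wreath_monoid M N A)"
    then show "\<one>\<^bsub>wreath_monoid M N A\<^esub> \<otimes>\<^bsub>wreath_monoid M N A\<^esub> u = u"
      by (cases u) (auto simp: mult_wreath_monoid A.act_one PiE_iff intro: extensionalityI)
  next
    fix u assume "u \<in> carrier (wreath_monoid M N A)"
    then show "u \<otimes>\<^bsub>wreath_monoid M N A\<^esub> \<one>\<^bsub>wreath_monoid M N A\<^esub> = u"
      by (cases u) (auto simp: mult_wreath_monoid A.act_closed PiE_iff intro: extensionalityI)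
  qed
qed

text \<open>The shift in the product records the order of action: (m, \<theta>) moves (a, b) to (am,
  b\<theta>(a)), so the next factor (n, \<phi>) is evaluated at am and contributes
  \<phi>(am).\<close>

lemma monoid_act_wreath_act:
  assumes "monoid_act M A" and "monoid_act N B"
  shows "monoid_act (wreath_monoid M N A) (wreath_act A B)"
proof -
  interpret A: monoid_act M A by fact
  interpret B: monoid_act N B by fact
  show ?thesis
  proof (rule monoid_act.intro[OF _ monoid_act_axioms.intro])
    show "monoid (wreath_monoid M N A)"
      using A.monoid_act_axioms B.monoid_axioms by (rule monoid_wreath_monoid)
  next
    show "carrier (wreath_act A B) \<noteq> {}"
      using A.nonempty B.nonempty by simp
  next
    fix c u assume "c \<in> carrier (wreath_act A B)" "u \<in> carrier (wreath_monoid M N A)"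
    then show "c \<star>\<^bsub>wreath_act A B\<^esub> u \<in> carrier (wreath_act A B)"
      by (cases c; cases u) (auto simp: A.act_closed B.act_closed PiE_iff)
  next
    fix c u v assume "c \<in> carrier (wreath_act A B)" "u \<in> carrier (wreath_monoid M N A)"
      "v \<in> carrier (wreath_monoid M N A)"
    then show "c \<star>\<^bsub>wreath_act A B\<^esub> (u \<otimes>\<^bsub>wreath_monoid M N A\<^esub> v) =
        (c \<star>\<^bsub>wreath_act A B\<^esub> u) \<star>\<^bsub>wreath_act A B\<^esub> v"
      by (cases c; cases u; cases v)
        (auto simp: mult_wreath_monoid A.act_closed A.act_mult B.act_mult PiE_iff)
  next
    fix c assume "c \<in> carrier (wreath_act A B)"
    then show "c \<star>\<^bsub>wreath_act A B\<^esub> \<one>\<^bsub>wreath_monoid M N A\<^esub> = c"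
      by (cases c) (auto simp: A.act_one B.act_one)
  qed
qed

theorem theorem5p3:
  fixes M :: "('m, 'p) monoid_scheme" and N :: "('n, 'q) monoid_scheme"
    and A :: "('a, 'm, 'r) right_act_scheme" and B :: "('b, 'n, 's) right_act_scheme"
    and X :: "'x set" and R :: "(('x \<times> 'm) \<times> ('x \<times> 'm)) set" and \<iota> :: "'x \<Rightarrow> 'a"
    and Y :: "'y set" and S :: "(('y \<times> 'n) \<times> ('y \<times> 'n)) set" and \<kappa> :: "'y \<Rightarrow> 'b"
    and T\<^sub>1 T\<^sub>2 T\<^sub>3 :: "((('x \<times> 'y) \<times> ('m \<times> ('a \<Rightarrow> 'n))) \<times> (('x \<times> 'y) \<times> ('m \<times> ('a \<Rightarrow> 'n)))) set"
  assumes "monoid M" and "monoid N"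
    and "monoid_act M A" and "monoid_act N B"
    and "defined_by_presentation M A X R \<iota>"
    and "defined_by_presentation N B Y S \<kappa>"
  defines "T\<^sub>1 \<equiv> {(((x, y), (\<one>\<^bsub>M\<^esub>, \<theta>)), ((x, y), (\<one>\<^bsub>M\<^esub>, const_map A (\<theta> (\<iota> x))))) | x y \<theta>.
              x \<in> X \<and> y \<in> Y \<and> \<theta> \<in> carrier A \<rightarrow>\<^sub>E carrier N}"
    and "T\<^sub>2 \<equiv> {(((x, y), (m, const_map A \<one>\<^bsub>N\<^esub>)), ((x', y), (m', const_map A \<one>\<^bsub>N\<^esub>))) | x y m x' m'.
              ((x, m), (x', m')) \<in> R \<and> y \<in> Y}"
    and "T\<^sub>3 \<equiv> {(((x, y), (\<one>\<^bsub>M\<^esub>, const_map A n)), ((x, y'), (\<one>\<^bsub>M\<^esub>, const_map A n'))) | x y n y' n'.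
              x \<in> X \<and> ((y, n), (y', n')) \<in> S}"
  shows "defined_by_presentation (wreath_monoid M N A) (wreath_act A B) (X \<times> Y) (T\<^sub>1 \<union> T\<^sub>2 \<union> T\<^sub>3)
           (\<lambda>(x, y). (\<iota> x, \<kappa> y))"
proof -
  interpret A: monoid_act M A by fact
  interpret B: monoid_act N B by fact
  let ?W = "wreath_monoid M N A" and ?T = "T\<^sub>1 \<union> T\<^sub>2 \<union> T\<^sub>3"
  let ?F = "free_act ?W (X \<times> Y)"
  let ?c = "const_map A"
  interpret W: monoid_act ?W "wreath_act A B"
    by (rule monoid_act_wreath_act) fact+
  define \<tau> where "\<tau> = generated_congruence ?W ?F ?T"

  \<comment> \<open>Facts extracted from the two given presentations\<close>
  have X: "X \<noteq> {}" and R: "R \<subseteq> carrier (free_act M X) \<times> carrier (free_act M X)"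
    using assms(5) by (simp_all add: defined_by_presentation_def)
  have Y: "Y \<noteq> {}" and S: "S \<subseteq> carrier (free_act N Y) \<times> carrier (free_act N Y)"
    using assms(6) by (simp_all add: defined_by_presentation_def)
  note presA = defined_by_presentation_iff[OF assms(3) X R, THEN iffD1, OF assms(5)]
  note presB = defined_by_presentation_iff[OF assms(4) Y S, THEN iffD1, OF assms(6)]
  have \<iota>: "\<iota> x \<in> carrier A" if "x \<in> X" for x
    using presA that by blast
  have \<kappa>: "\<kappa> y \<in> carrier B" if "y \<in> Y" for y
    using presB that by blast
  have eval: "\<theta> (\<iota> x) \<in> carrier N" if "\<theta> \<in> carrier A \<rightarrow>\<^sub>E carrier N" "x \<in> X" for \<theta> x
    using that(1) \<iota>[OF that(2)] by (rule PiE_mem)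
  \<comment> \<open>Pairs in \<open>R\<close> belong to the congruence generated by
    \<open>R\<close>, so the kernel condition for \<open>A\<close> turns them into
    equations.\<close>
  have relR: "\<iota> x \<star>\<^bsub>A\<^esub> m = \<iota> x' \<star>\<^bsub>A\<^esub> m'" if "((x, m), (x', m')) \<in> R" for x m x' m'
    using that presA R subset_generated_congruence[of R] by fastforce
  have relS: "\<kappa> y \<star>\<^bsub>B\<^esub> n = \<kappa> y' \<star>\<^bsub>B\<^esub> n'" if "((y, n), (y', n')) \<in> S" for y n y' n'
    using that presB S subset_generated_congruence[of S] by fastforce

  \<comment> \<open>The congruence \<tau> and the moves available inside it\<close>
  have T: "?T \<subseteq> carrier ?F \<times> carrier ?F"
  proof -
    have "T\<^sub>1 \<subseteq> carrier ?F \<times> carrier ?F"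
      by (auto simp: T\<^sub>1_def eval intro!: const_map_closed)
    moreover have "T\<^sub>2 \<subseteq> carrier ?F \<times> carrier ?F" "T\<^sub>3 \<subseteq> carrier ?F \<times> carrier ?F"
      using R S by (auto simp: T\<^sub>2_def T\<^sub>3_def intro!: const_map_closed)
    ultimately show ?thesis by blast
  qed
  have \<tau>: "act_congruence ?W ?F \<tau>"
    unfolding \<tau>_def using T by (rule act_congruence_generated) (rule free_act_closed[OF W.monoid_axioms])
  then have E: "equiv (carrier ?F) \<tau>"
    by (simp add: act_congruence_def)
  have \<tau>_trans: "(u, w) \<in> \<tau>" if "(u, v) \<in> \<tau>" "(v, w) \<in> \<tau>" for u v w
    using E that by (meson equivE transD)
  have \<tau>_sym: "(v, u) \<in> \<tau>" if "(u, v) \<in> \<tau>" for u v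
    using E that by (meson equivE symD)
  have \<tau>_act: "((z, u \<otimes>\<^bsub>?W\<^esub> w), (z', v \<otimes>\<^bsub>?W\<^esub> w)) \<in> \<tau>"
    if "((z, u), (z', v)) \<in> \<tau>" "w \<in> carrier ?W" for z z' u v w
    using \<tau> that unfolding act_congruence_def by fastforce
  have T_\<tau>: "(u, v) \<in> \<tau>" if "(u, v) \<in> ?T" for u v
    using that subset_generated_congruence[of ?T] unfolding \<tau>_def by blast
  \<comment> \<open>In each of these products the right factor carries a constant map, which the
    shift leaves unchanged. \<open>c1_mult\<close> keeps \<open>k\<close> and \<open>n\<close> free:
    n = 1 gives equivariance in \<open>changeA\<close>, and k = 1 gives multiplication by (1,
    c_n).\<close>
  have mult_c1: "(\<one>\<^bsub>M\<^esub>, \<theta>) \<otimes>\<^bsub>?W\<^esub> (m, ?c \<one>\<^bsub>N\<^esub>) = (m, \<theta>)"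
    if "m \<in> carrier M" "\<theta> \<in> carrier A \<rightarrow>\<^sub>E carrier N" for m \<theta>
    using that by (auto simp: mult_wreath_monoid A.act_one PiE_iff intro: extensionalityI)
  have c1_mult: "(m, ?c \<one>\<^bsub>N\<^esub>) \<otimes>\<^bsub>?W\<^esub> (k, ?c n) = (m \<otimes>\<^bsub>M\<^esub> k, ?c n)"
    if "m \<in> carrier M" "n \<in> carrier N" for m k n
    using that by (auto simp: mult_wreath_monoid A.act_closed const_map_def)
  have c_mult: "(\<one>\<^bsub>M\<^esub>, ?c n) \<otimes>\<^bsub>?W\<^esub> (\<one>\<^bsub>M\<^esub>, ?c k) = (\<one>\<^bsub>M\<^esub>, ?c (n \<otimes>\<^bsub>N\<^esub> k))" for n k
    by (auto simp: mult_wreath_monoid A.act_one const_map_def)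
  \<comment> \<open>Acting by (m, c_1) on a relation of \<open>T\<^sub>1\<close> inserts m and keeps
    both maps. The value is taken at \<open>\<iota> x\<close>, not at its image under m, because the
    wreath act evaluates the map before m moves the point.\<close>
  have normal: "(((x, y), (m, \<theta>)), ((x, y), (m, ?c (\<theta> (\<iota> x))))) \<in> \<tau>"
    if "x \<in> X" "y \<in> Y" "m \<in> carrier M" "\<theta> \<in> carrier A \<rightarrow>\<^sub>E carrier N" for x y m \<theta>
  proof -
    have "(((x, y), (\<one>\<^bsub>M\<^esub>, \<theta>)), ((x, y), (\<one>\<^bsub>M\<^esub>, ?c (\<theta> (\<iota> x))))) \<in> \<tau>"
      using that by (intro T_\<tau>) (auto simp: T\<^sub>1_def)
    from \<tau>_act[OF this, of "(m, ?c \<one>\<^bsub>N\<^esub>)"] show ?thesis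
      using that eval by (simp add: mult_c1 const_map_closed)
  qed
  have changeA: "(((x, y), (m, ?c n)), ((x', y), (m', ?c n))) \<in> \<tau>"
    if xm: "((x, m), (x', m')) \<in> generated_congruence M (free_act M X) R"
      and "m \<in> carrier M" "m' \<in> carrier M" "y \<in> Y" "n \<in> carrier N" for x m x' m' y n
  proof -
    let ?f = "\<lambda>(x, m). ((x, y), (m, ?c \<one>\<^bsub>N\<^esub>))"
    have "(?f (x, m), ?f (x', m')) \<in> \<tau>"
    proof (rule generated_congruence_map[OF xm \<tau> R, where g = "\<lambda>m. (m, ?c \<one>\<^bsub>N\<^esub>)"])
      show "(?f a, ?f b) \<in> \<tau>" if "(a, b) \<in> R" for a b
        using that \<open>y \<in> Y\<close> by (cases a; cases b) (auto intro!: T_\<tau> simp: T\<^sub>2_def)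
    qed (use \<open>y \<in> Y\<close> in \<open>auto simp: c1_mult intro!: const_map_closed\<close>)
    then have "(((x, y), (m, ?c \<one>\<^bsub>N\<^esub>)), ((x', y), (m', ?c \<one>\<^bsub>N\<^esub>))) \<in> \<tau>"
      by simp
    \<comment> \<open>Acting by (1, c_n) replaces c_1 by c_n on both sides at once.\<close>
    from \<tau>_act[OF this, of "(\<one>\<^bsub>M\<^esub>, ?c n)"] show ?thesis
      using that by (simp add: c1_mult const_map_closed)
  qed
  have changeB: "(((x, y), (m, ?c n)), ((x, y'), (m, ?c n'))) \<in> \<tau>"
    if yn: "((y, n), (y', n')) \<in> generated_congruence N (free_act N Y) S"
      and "n \<in> carrier N" "n' \<in> carrier N" "x \<in> X" "m \<in> carrier M" for y n y' n' x m
  proof -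
    let ?f = "\<lambda>(y, n). ((x, y), (\<one>\<^bsub>M\<^esub>, ?c n))"
    have "(?f (y, n), ?f (y', n')) \<in> \<tau>"
    proof (rule generated_congruence_map[OF yn \<tau> S, where g = "\<lambda>n. (\<one>\<^bsub>M\<^esub>, ?c n)"])
      show "(?f a, ?f b) \<in> \<tau>" if "(a, b) \<in> S" for a b
        using that \<open>x \<in> X\<close> by (cases a; cases b) (auto intro!: T_\<tau> simp: T\<^sub>3_def)
    qed (use \<open>x \<in> X\<close> in \<open>auto simp: c_mult intro!: const_map_closed\<close>)
    then have "(((x, y), (\<one>\<^bsub>M\<^esub>, ?c n)), ((x, y'), (\<one>\<^bsub>M\<^esub>, ?c n'))) \<in> \<tau>"
      by simp
    \<comment> \<open>Here the extra factor (m, c_1) inserts m and leaves the constants n and n' as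
      they are.\<close>
    from \<tau>_act[OF this, of "(m, ?c \<one>\<^bsub>N\<^esub>)"] show ?thesis
      using that by (simp add: mult_c1 const_map_closed)
  qed

  \<comment> \<open>The evaluation map \<open>p\<close> and its kernel\<close>
  define p where "p = (\<lambda>((x, y), (m, \<theta>)). (\<iota> x \<star>\<^bsub>A\<^esub> m, \<kappa> y \<star>\<^bsub>B\<^esub> \<theta> (\<iota> x)))"
  have sound: "p u = p v" if "(u, v) \<in> \<tau>" for u v
  proof -
    \<comment> \<open>Equality is written as the congruence \<open>Id_on\<close>, whose pullback
      along \<open>p\<close> is the kernel of \<open>p\<close>. Both acts are over the wreath
      monoid, whence \<open>g = id\<close>.\<close>
    have "(p u, p v) \<in> Id_on (carrier (wreath_act A B))"
    proof (rule generated_congruence_map[OF that[unfolded \<tau>_def] _ T, where g = id])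
      show "act_congruence ?W (wreath_act A B) (Id_on (carrier (wreath_act A B)))"
        unfolding act_congruence_def
        using W.act_closed by (auto simp: equiv_def refl_on_def sym_def trans_def)
      show p: "p a \<in> carrier (wreath_act A B)" if "a \<in> carrier ?F" for a
        using that \<iota> \<kappa> by (auto simp: p_def A.act_closed B.act_closed eval)
      show "(p a, p b) \<in> Id_on (carrier (wreath_act A B))" if ab: "(a, b) \<in> ?T" for a b
      proof -
        \<comment> \<open>For \<open>T\<^sub>1\<close>, \<theta> and the constant map agree at
          \<open>\<iota> x\<close>, the only point where \<open>p\<close> evaluates them.
          \<open>T\<^sub>2\<close> reduces to \<open>relR\<close> and \<open>T\<^sub>3\<close> to
          \<open>relS\<close>.\<close>
        have "p a = p b"
          using ab R \<iota> relR relS by (auto simp: p_def T\<^sub>1_def T\<^sub>2_def T\<^sub>3_def)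
        then show ?thesis
          using ab T p by auto
      qed
      show "p (a \<star>\<^bsub>?F\<^esub> w) = p a \<star>\<^bsub>wreath_act A B\<^esub> id w"
        if "a \<in> carrier ?F" "w \<in> carrier ?W" for a w
        using that \<iota> \<kappa>
        by (cases w) (auto simp: p_def mult_wreath_monoid A.act_mult B.act_mult A.act_closed PiE_iff)
      show "a \<star>\<^bsub>?F\<^esub> w \<in> carrier ?F" if "a \<in> carrier ?F" "w \<in> carrier ?W" for a w
        using W.monoid_axioms that by (rule free_act_closed)
    qed simp
    then show ?thesis by auto
  qed
  \<comment> \<open>The path in \<tau> is: normalise the left side, replace (x, m) by (x', m') with
    y and the constant fixed, replace y and the constant, then undo the normalisation on the right.
    The second move is possible because, after normalisation, the value \<theta>(\<iota> x) is a
    constant no longer tied to x.\<close>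
  have complete: "(((x, y), (m, \<theta>)), ((x', y'), (m', \<theta>'))) \<in> \<tau>"
    if x: "x \<in> X" "x' \<in> X" and y: "y \<in> Y" "y' \<in> Y" and m: "m \<in> carrier M" "m' \<in> carrier M"
      and \<theta>: "\<theta> \<in> carrier A \<rightarrow>\<^sub>E carrier N" "\<theta>' \<in> carrier A \<rightarrow>\<^sub>E carrier N"
      and eq: "p ((x, y), (m, \<theta>)) = p ((x', y'), (m', \<theta>'))" for x y m \<theta> x' y' m' \<theta>'
  proof -
    have n: "\<theta> (\<iota> x) \<in> carrier N" "\<theta>' (\<iota> x') \<in> carrier N"
      using \<theta> x by (simp_all add: eval)
    \<comment> \<open>The first component of \<open>eq\<close> is the kernel condition for
      \<open>A\<close>; the second component serves for \<open>B\<close> below.\<close>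
    have "((x, m), (x', m')) \<in> generated_congruence M (free_act M X) R"
      using presA x m eq by (simp add: p_def)
    then have 1: "(((x, y), (m, ?c (\<theta> (\<iota> x)))), ((x', y), (m', ?c (\<theta> (\<iota> x))))) \<in> \<tau>"
      using m y n by (intro changeA)
    have "((y, \<theta> (\<iota> x)), (y', \<theta>' (\<iota> x'))) \<in> generated_congruence N (free_act N Y) S"
      using presB y n eq by (simp add: p_def)
    then have 2: "(((x', y), (m', ?c (\<theta> (\<iota> x)))), ((x', y'), (m', ?c (\<theta>' (\<iota> x'))))) \<in> \<tau>"
      using m x n by (intro changeB)
    show ?thesis
      using normal[OF x(1) y(1) m(1) \<theta>(1)] 1 2 \<tau>_sym[OF normal[OF x(2) y(2) m(2) \<theta>(2)]]
      by (blast intro: \<tau>_trans)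
  qed

  \<comment> \<open>Verification of the criterion for the wreath act\<close>
  have "X \<times> Y \<noteq> {}"
    using X Y by simp
  from defined_by_presentation_iff[OF W.monoid_act_axioms this T] show ?thesis
  proof (rule iffD2, intro conjI)
    show "\<forall>z\<in>X \<times> Y. (case z of (x, y) \<Rightarrow> (\<iota> x, \<kappa> y)) \<in> carrier (wreath_act A B)"
      using \<iota> \<kappa> by auto
    show "\<forall>c\<in>carrier (wreath_act A B). \<exists>z\<in>X \<times> Y. \<exists>w\<in>carrier ?W.
        c = (case z of (x, y) \<Rightarrow> (\<iota> x, \<kappa> y)) \<star>\<^bsub>wreath_act A B\<^esub> w"
    proof
      fix c assume "c \<in> carrier (wreath_act A B)"
      then obtain a b where c: "c = (a, b)" "a \<in> carrier A" "b \<in> carrier B"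
        by auto
      then obtain x m y n where "x \<in> X" "m \<in> carrier M" "a = \<iota> x \<star>\<^bsub>A\<^esub> m"
        "y \<in> Y" "n \<in> carrier N" "b = \<kappa> y \<star>\<^bsub>B\<^esub> n"
        using presA presB by meson
      \<comment> \<open>Only the value at \<open>\<iota> x\<close> affects the second coordinate, so
        the constant map \<open>?c n\<close> suffices to reach b.\<close>
      with c \<iota> show "\<exists>z\<in>X \<times> Y. \<exists>w\<in>carrier ?W.
          c = (case z of (x, y) \<Rightarrow> (\<iota> x, \<kappa> y)) \<star>\<^bsub>wreath_act A B\<^esub> w"
        by (intro bexI[of _ "(x, y)"] bexI[of _ "(m, ?c n)"]) (auto simp: const_map_closed)
    qed
    show "\<forall>z\<in>X \<times> Y. \<forall>w\<in>carrier ?W. \<forall>z'\<in>X \<times> Y. \<forall>w'\<in>carrier ?W.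
        ((z, w), (z', w')) \<in> generated_congruence ?W ?F ?T \<longleftrightarrow>
        (case z of (x, y) \<Rightarrow> (\<iota> x, \<kappa> y)) \<star>\<^bsub>wreath_act A B\<^esub> w =
        (case z' of (x, y) \<Rightarrow> (\<iota> x, \<kappa> y)) \<star>\<^bsub>wreath_act A B\<^esub> w'"
    proof (intro ballI)
      fix z w z' w'
      assume zw: "z \<in> X \<times> Y" "w \<in> carrier ?W" "z' \<in> X \<times> Y" "w' \<in> carrier ?W"
      \<comment> \<open>This identifies the map of the criterion with \<open>p\<close>, so that
        \<open>sound\<close> and \<open>complete\<close> are the two directions of the kernel
        condition.\<close>
      have p: "(case z of (x, y) \<Rightarrow> (\<iota> x, \<kappa> y)) \<star>\<^bsub>wreath_act A B\<^esub> w = p (z, w)" for z w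
        by (cases z; cases w) (simp add: p_def)
      have "((z, w), (z', w')) \<in> \<tau> \<longleftrightarrow> p (z, w) = p (z', w')"
      proof
        show "p (z, w) = p (z', w')" if "((z, w), (z', w')) \<in> \<tau>"
          using that by (rule sound)
        obtain x y m \<theta> x' y' m' \<theta>'
          where "z = (x, y)" "w = (m, \<theta>)" "z' = (x', y')" "w' = (m', \<theta>')"
          by (cases z; cases w; cases z'; cases w')
        then show "((z, w), (z', w')) \<in> \<tau>" if "p (z, w) = p (z', w')"
          using that zw complete[of x x' y y' m m' \<theta> \<theta>'] by simp
      qed
      then show "((z, w), (z', w')) \<in> generated_congruence ?W ?F ?T \<longleftrightarrow>
        (case z of (x, y) \<Rightarrow> (\<iota> x, \<kappa> y)) \<star>\<^bsub>wreath_act A B\<^esub> w =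
        (case z' of (x, y) \<Rightarrow> (\<iota> x, \<kappa> y)) \<star>\<^bsub>wreath_act A B\<^esub> w'"
        unfolding p \<tau>_def .
    qed
  qed
qed

end
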